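(* Let $q=2$, $A=\mathbb{F}_2[t]$, $K=\mathbb{F}_2(t)$. Let $a,b$ be integers with $a>b\ge1$ and let $m$ be the smallest nonnegative integer with $a\le 2^m$. Then $$\Delta(a,b)=\sum_{k=0}^{a-1}f_kS_1(a-k),\qquad f_k=\sum_{\substack{i+j=k\\ 0\le i\le 2^m-a\\ 0\le j\le a-b-1}}\binom{2^m-a}{i}\binom{a-b}{j}\in\mathbb{F}_2 .$$
   Context: For $s\in\mathbb{Z}$, $S_1(s)=t^{-s}+(t+1)^{-s}\in K$ (the sum of $n^{-s}$ over the monic polynomials $n$ of degree $1$). For $a,b\in\mathbb{Z}_+$, $\Delta(a,b)=S_1(a)S_1(b)-S_1(a+b)$. *)

theory Defs
  imports "HOL-Library.Z2" "HOL-Computational_Algebra.Computational_Algebra"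
begin

text \<open>
  The type \<open>bit\<close> is the field with two elements, so \<open>bit poly\<close> is \<open>A = F\<^sub>2[t]\<close>
  and its fraction field \<open>bit poly fract\<close> is \<open>K = F\<^sub>2(t)\<close>.
\<close>

type_synonym K = "bit poly fract"

definition tK :: K where
  "tK = to_fract [:0, 1:]"

definition constK :: "bit \<Rightarrow> K" where
  "constK c = to_fract [:c:]"

definition S1 :: "int \<Rightarrow> K" where
  "S1 s = tK powi (- s) + (tK + 1) powi (- s)"

lemma monic_degree_one_eq:
  "{n :: bit poly. lead_coeff n = 1 \<and> degree n = 1} = {[:0, 1:], [:1, 1:]}"
proof -
  have "n = [:0, 1:] \<or> n = [:1, 1:]" if n: "lead_coeff n = 1" "degree n = 1" for n :: "bit poly"
  proof -
    have "n = [:coeff n 0, 1:]"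
    proof (rule poly_eqI)
      fix i
      show "coeff n i = coeff [:coeff n 0, 1:] i"
        using n by (cases i) (auto simp: coeff_pCons coeff_eq_0 split: nat.splits)
    qed
    then show ?thesis
      by (cases "coeff n 0") auto
  qed
  moreover have "lead_coeff [:0, 1 :: bit:] = 1" "degree [:0, 1 :: bit:] = 1"
    "lead_coeff [:1, 1 :: bit:] = 1" "degree [:1, 1 :: bit:] = 1"
    by simp_all
  ultimately show ?thesis by blast
qed

text \<open>The defining formula of \<open>S1\<close> is the power sum over the monic polynomials of degree one.\<close>

lemma S1_eq_sum_monic:
  "S1 s = (\<Sum>n | lead_coeff n = 1 \<and> degree n = 1. to_fract n powi (- s))"
proof -
  have "to_fract [:1, 1:] = tK + 1"
    unfolding tK_def by (simp flip: to_fract_1 to_fract_add add: one_pCons)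
  then show ?thesis
    unfolding monic_degree_one_eq S1_def by (simp add: tK_def)
qed

definition Delta :: "nat \<Rightarrow> nat \<Rightarrow> K" where
  "Delta a b = S1 (int a) * S1 (int b) - S1 (int (a + b))"

text \<open>
  The coefficient \<open>f\<^sub>k\<close>. The subtractions on \<open>nat\<close> do not truncate when
  \<open>b < a \<le> 2 ^ m\<close>.
\<close>

definition f_coeff :: "nat \<Rightarrow> nat \<Rightarrow> nat \<Rightarrow> nat \<Rightarrow> bit" where
  "f_coeff m a b k =
    (\<Sum>(i, j) \<in> {(i, j). i + j = k \<and> i \<le> 2 ^ m - a \<and> j \<le> a - b - 1}.
       of_nat (((2 ^ m - a) choose i) * ((a - b) choose j)))"

end

theory Submission
  imports Defs
begin

text \<open>
  Put \<open>X = t\<close>, \<open>Y = t + 1\<close>, \<open>c = a - b\<close> and \<open>G = Y ^ (2 ^ m - a) * (Y ^ c - X ^ c)\<close>, whose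
  coefficients are the \<open>f\<^sub>k\<close> without the restriction \<open>k < a\<close>. Since \<open>t \<mapsto> t + 1\<close> swaps \<open>X\<close> and \<open>Y\<close>
  and \<open>Y ^ 2 ^ m - X ^ 2 ^ m = 1\<close>, we get \<open>G(X) * Y ^ a + G(Y) * X ^ a = Y ^ c - X ^ c\<close>, which after
  division by \<open>X ^ a * Y ^ a\<close> is the claim with the sum over all \<open>k\<close>. The terms with \<open>k \<ge> a\<close>
  contribute a polynomial multiple of \<open>X ^ a * Y ^ a\<close>, which vanishes because all other terms have
  degree below \<open>2 * a\<close>.
\<close>

lemma poly_cutoff_plus_shift:
  fixes p :: "'a::comm_semiring_1 poly"
  shows "p = poly_cutoff n p + [:0, 1:] ^ n * poly_shift n p"
  by (rule poly_eqI)
    (simp add: coeff_poly_cutoff coeff_poly_shift coeff_monom_mult flip: monom_altdef[of 1, simplified])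

lemma degree_poly_cutoff_less: "n > 0 \<Longrightarrow> degree (poly_cutoff n p) < n"
  by (rule degree_lessI) (auto simp: coeff_poly_cutoff)

text \<open>The tail \<open>r\<close> beyond degree \<open>n\<close> need not vanish. Only its
  symmetrized form \<open>e\<close>, the sum of \<open>r\<close> and its composition with
  \<open>[:1, 1:]\<close>, is forced to be zero.\<close>

lemma reflection_identity_poly_cutoff:
  fixes p d :: "'a::idom poly"
  assumes p: "p * [:1, 1:] ^ n + pcompose p [:1, 1:] * [:0, 1:] ^ n = d"
    and d: "degree d < 2 * n"
  shows "poly_cutoff n p * [:1, 1:] ^ n + pcompose (poly_cutoff n p) [:1, 1:] * [:0, 1:] ^ n = d"
proof -
  define q where "q = poly_cutoff n p"
  define r where "r = poly_shift n p"
  define e where "e = r + pcompose r [:1, 1:]"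
  define s where "s = q * [:1, 1:] ^ n + pcompose q [:1, 1:] * [:0, 1:] ^ n"
  have pqr: "p = q + [:0, 1:] ^ n * r"
    unfolding q_def r_def by (rule poly_cutoff_plus_shift)
  have "pcompose ([:0, 1:] ^ n) [:1, 1:] = ([:1, 1:] ^ n :: 'a poly)"
    by (induction n) (simp_all add: pcompose_mult pcompose_pCons pcompose_1)
  then have comp: "pcompose p [:1, 1:] = pcompose q [:1, 1:] + [:1, 1:] ^ n * pcompose r [:1, 1:]"
    by (simp add: pqr pcompose_add pcompose_mult)
  \<comment> \<open>Both tails carry the same factor: one takes \<open>[:0, 1:] ^ n\<close> from the
    splitting of \<open>p\<close> and \<open>[:1, 1:] ^ n\<close> from its multiplier, the other the
    reverse.\<close>
  have split: "d = s + [:0, 1:] ^ n * [:1, 1:] ^ n * e"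
    unfolding p[symmetric] comp s_def e_def by (subst pqr) (simp only: algebra_simps)
  have "n > 0" using d by simp
  then have q: "degree q < n"
    unfolding q_def by (rule degree_poly_cutoff_less)
  have pw: "degree ([:c, 1:] ^ n :: 'a poly) = n" for c
    by (simp add: degree_power_eq)
  have "degree (q * [:1, 1:] ^ n) < 2 * n"
    using degree_mult_le[of q "[:1, 1:] ^ n"] q pw[of 1] by linarith
  moreover have "degree (pcompose q [:1, 1:] * [:0, 1:] ^ n) < 2 * n"
    using degree_mult_le[of "pcompose q [:1, 1:]" "[:0, 1:] ^ n"] q pw[of 0]
    by (simp add: degree_pcompose)
  ultimately have "degree s < 2 * n"
    unfolding s_def by (rule degree_add_less)
  then have "degree (d - s) < 2 * n"
    using d by (intro degree_diff_less)
  moreover have "degree (d - s) \<ge> 2 * n" if "e \<noteq> 0"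
    using that by (simp add: split degree_mult_eq pw)
  ultimately have "e = 0" by fastforce
  then show ?thesis using split by (simp add: q_def s_def)
qed

lemma coeff_shifted_power: "coeff ([:1, 1:] ^ n :: 'a::comm_semiring_1 poly) i = of_nat (n choose i)"
proof (cases "i \<le> n")
  case False
  have "degree ([:1, 1:] ^ n :: 'a poly) \<le> n"
    using degree_power_le[of "[:1, 1:] :: 'a poly" n] by simp
  with False show ?thesis by (simp add: coeff_eq_0 binomial_eq_0)
qed (simp add: coeff_linear_poly_power)

text \<open>Subtracting \<open>[:0, 1:] ^ c\<close> deletes exactly the top term of the binomial
  expansion of \<open>[:1, 1:] ^ c\<close>, hence the range \<open>j \<le> c - 1\<close>; the rest
  is a Cauchy product.\<close>

lemma coeff_shifted_power_mult_diff:
  assumes "c > 0"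
  shows "coeff ([:1, 1:] ^ n * ([:1, 1:] ^ c - [:0, 1:] ^ c)) k =
    (\<Sum>(i, j) | i + j = k \<and> i \<le> n \<and> j \<le> c - 1. of_nat ((n choose i) * (c choose j)) :: 'a::comm_ring_1)"
proof -
  let ?S = "{(i, j). i + j = k \<and> i \<le> n \<and> j \<le> c - 1}"
  have low: "coeff ([:1, 1:] ^ c - [:0, 1:] ^ c :: 'a poly) j = (if j \<le> c - 1 then of_nat (c choose j) else 0)" for j
    using assms coeff_monom[of "1::'a" c j] 
    by (auto simp: coeff_shifted_power monom_altdef binomial_eq_0)
  have "coeff ([:1, 1:] ^ n * ([:1, 1:] ^ c - [:0, 1:] ^ c)) k =
      (\<Sum>i\<le>k. of_nat (n choose i) * (if k - i \<le> c - 1 then of_nat (c choose (k - i)) else 0 :: 'a))"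
    by (simp only: coeff_mult low coeff_shifted_power)
  also have "\<dots> = (\<Sum>i | i \<le> k \<and> i \<le> n \<and> k - i \<le> c - 1. of_nat ((n choose i) * (c choose (k - i))))"
    by (rule sum.mono_neutral_cong_right) (auto intro: ccontr simp: not_le binomial_eq_0)
  also have "\<dots> = (\<Sum>(i, j) \<in> ?S. of_nat ((n choose i) * (c choose j)))"
    by (rule sum.reindex_bij_witness[of _ fst "\<lambda>i. (i, k - i)"]) auto
  finally show ?thesis .
qed

lemma to_fract_sum: "to_fract (sum f A) = (\<Sum>x\<in>A. to_fract (f x))"
  by (induction A rule: infinite_finite_induct) simp_all

lemma to_fract_power: "to_fract (x ^ n) = to_fract x ^ n"
  by (induction n) simp_all

text \<open>Bounding by any \<open>n\<close> above the degree gives a summation range independent of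
  the actual degree of \<open>p\<close>.\<close>

lemma to_fract_pcompose:
  assumes "degree p < n"
  shows "to_fract (pcompose p q) = (\<Sum>k<n. constK (coeff p k) * to_fract q ^ k)"
proof -
  have "pcompose p q = (\<Sum>k\<le>degree p. [:coeff p k:] * q ^ k)"
    by (simp add: pcompose_altdef poly_altdef coeff_map_poly degree_map_poly)
  also have "\<dots> = (\<Sum>k<n. [:coeff p k:] * q ^ k)"
    using assms by (intro sum.mono_neutral_left) (auto simp: coeff_eq_0)
  finally show ?thesis
    by (simp only: to_fract_sum to_fract_mult to_fract_power constK_def)
qed

lemma bit_poly_add_self: "p + p = (0 :: bit poly)"
  by (rule poly_eqI) (simp only: coeff_add coeff_0 add_bit_eq_xor, simp)

lemma bit_poly_diff_eq_add: "p - q = p + (q :: bit poly)"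
  by (rule poly_eqI) simp

text \<open>Frobenius: in characteristic 2 squaring is additive, and it is iterated \<open>m\<close>
  times.\<close>

lemma shifted_power_two_power_diff: "[:1, 1:] ^ 2 ^ m - [:0, 1:] ^ 2 ^ m = (1 :: bit poly)"
proof -
  have "([:0, 1:] + 1 :: bit poly) ^ 2 ^ m = [:0, 1:] ^ 2 ^ m + 1"
  proof (induction m)
    case (Suc m)
    have "(p + 1)\<^sup>2 = p\<^sup>2 + 1" for p :: "bit poly"
      by (simp add: power2_eq_square algebra_simps bit_poly_add_self flip: add.assoc)
    with Suc show ?case by (simp add: power_mult mult.commute[of 2])
  qed simp
  then show ?thesis by (simp add: one_pCons)
qed

theorem theorem6p1:
  fixes a b m :: nat
  assumes "a > b" and "b \<ge> 1"
    and "m = (LEAST l. a \<le> 2 ^ l)"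
  shows "Delta a b = (\<Sum>k = 0..a - 1. constK (f_coeff m a b k) * S1 (int (a - k)))"
proof -
  \<comment> \<open>The exponent \<open>a\<close> itself is a witness, as
    \<open>a < 2 ^ a\<close>.\<close>
  have am: "a \<le> 2 ^ m"
    unfolding assms(3) by (rule LeastI[of _ a]) (simp add: less_imp_le)
  define c where "c = a - b"
  have c: "c > 0" "a = c + b" using assms(1) by (simp_all add: c_def)
  define X Y :: "bit poly" where "X = [:0, 1:]" and "Y = [:1, 1:]"
  define G where "G = Y ^ (2 ^ m - a) * (Y ^ c - X ^ c)"
  define F where "F = poly_cutoff a G"
  have XY: "pcompose X Y = Y" "pcompose Y Y = X"
    by (simp_all add: X_def Y_def pcompose_pCons)
  have Xc: "pcompose (X ^ i) Y = Y ^ i" and Yc: "pcompose (Y ^ i) Y = X ^ i" for i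
    by (induction i) (simp_all add: pcompose_mult pcompose_1 XY)
  have "G * Y ^ a + pcompose G Y * X ^ a = Y ^ 2 ^ m * (Y ^ c - X ^ c) + X ^ 2 ^ m * (X ^ c - Y ^ c)"
  proof -
    \<comment> \<open>As \<open>a \<le> 2 ^ m\<close>, the exponents \<open>2 ^ m - a\<close> and
      \<open>a\<close> add up to \<open>2 ^ m\<close>; this is applied with \<open>Z = Y\<close> and
      with \<open>Z = X\<close>.\<close>
    have "Z ^ (2 ^ m - a) * W * Z ^ a = Z ^ 2 ^ m * W" for Z W :: "bit poly"
      using am by (simp add: mult.commute mult.left_commute flip: power_add)
    then show ?thesis
      by (simp only: G_def pcompose_mult pcompose_diff Xc Yc)
  qed
  also have "\<dots> = (Y ^ 2 ^ m - X ^ 2 ^ m) * (Y ^ c - X ^ c)"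
    by (simp only: algebra_simps)
  also have "\<dots> = X ^ c + Y ^ c"
    unfolding X_def Y_def shifted_power_two_power_diff
    by (simp add: bit_poly_diff_eq_add add.commute)
  finally have "G * Y ^ a + pcompose G Y * X ^ a = X ^ c + Y ^ c" .
  moreover have "degree (X ^ c + Y ^ c) < 2 * a"
  proof (rule degree_add_less)
    show "degree (X ^ c) < 2 * a" "degree (Y ^ c) < 2 * a"
      using c by (simp_all add: X_def Y_def degree_power_eq)
  qed
  ultimately have F: "F * Y ^ a + pcompose F Y * X ^ a = X ^ c + Y ^ c"
    unfolding F_def X_def Y_def by (rule reflection_identity_poly_cutoff)
  have cF: "coeff F k = f_coeff m a b k" if "k < a" for k
    using that coeff_shifted_power_mult_diff[OF c(1), of "2 ^ m - a" k, where 'a = bit]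
    by (simp only: F_def G_def X_def Y_def coeff_poly_cutoff f_coeff_def c_def if_True)
  have dF: "degree F < a"
    unfolding F_def using c by (intro degree_poly_cutoff_less) simp
  define x y where "x = to_fract X" and "y = to_fract Y"
  have xy: "tK = x" "tK + 1 = y" "x \<noteq> 0" "y \<noteq> 0"
    unfolding tK_def x_def y_def X_def Y_def
    by (simp_all flip: to_fract_1 to_fract_add add: one_pCons)
  have S1: "S1 (int n) = inverse x ^ n + inverse y ^ n" for n
    unfolding S1_def xy(2) unfolding xy(1) by (simp add: power_int_minus power_inverse)
  have Fx: "to_fract F = (\<Sum>k<a. constK (f_coeff m a b k) * x ^ k)"
    using to_fract_pcompose[OF dF, of X] by (simp add: X_def x_def cF)
  have Fy: "to_fract (pcompose F Y) = (\<Sum>k<a. constK (f_coeff m a b k) * y ^ k)"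
    using to_fract_pcompose[OF dF, of Y] by (simp add: y_def cF)
  have "{0..a - 1} = {..<a}" using c by auto
  then have "(\<Sum>k = 0..a - 1. constK (f_coeff m a b k) * S1 (int (a - k))) =
      (\<Sum>k<a. constK (f_coeff m a b k) * (inverse x ^ (a - k) + inverse y ^ (a - k)))"
    by (simp only: S1)
  \<comment> \<open>Pulling out the common denominators leaves the values of \<open>F\<close> at
    \<open>x\<close> and at \<open>y\<close>.\<close>
  also have "\<dots> = (\<Sum>k<a. constK (f_coeff m a b k) * x ^ k * inverse x ^ a +
      constK (f_coeff m a b k) * y ^ k * inverse y ^ a)"
    using xy(3,4)
    by (intro sum.cong refl) (simp add: power_diff divide_simps power_inverse distrib_left)
  also have "\<dots> = to_fract F * inverse x ^ a + to_fract (pcompose F Y) * inverse y ^ a"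
    by (simp only: Fx Fy sum.distrib sum_distrib_right)
  also have "\<dots> = (to_fract F * y ^ a + to_fract (pcompose F Y) * x ^ a) / (x ^ a * y ^ a)"
    using xy(3,4) by (simp add: field_simps power_inverse)
  also have "to_fract F * y ^ a + to_fract (pcompose F Y) * x ^ a = x ^ c + y ^ c"
    using arg_cong[OF F, of to_fract] by (simp add: x_def y_def to_fract_power)
  \<comment> \<open>Since \<open>a = c + b\<close>, cancelling \<open>x ^ c\<close> or
    \<open>y ^ c\<close> leaves exponent \<open>b\<close> on one variable: these are the cross terms
    of \<open>S1 a * S1 b\<close>, whose other two terms make up \<open>S1 (a + b)\<close>.\<close>
  also have "(x ^ c + y ^ c) / (x ^ a * y ^ a) =
      inverse x ^ a * inverse y ^ b + inverse x ^ b * inverse y ^ a"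
    using xy(3,4) by (simp add: c(2) field_simps power_add power_inverse)
  also have "\<dots> = Delta a b"
    by (simp only: Delta_def S1 of_nat_add flip: of_nat_add) (simp add: algebra_simps power_add)
  finally show ?thesis ..
qed

end
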